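(* Let $(X_1,f_1)$ and $(X_2,f_2)$ be two systems that are isomorphic modulo countable invariant sets, via totally invariant countable sets $N_1\subset X_1$, $N_2\subset X_2$ and a bimeasurable bijection $\psi:X_1\setminus N_1\to X_2\setminus N_2$ with $f_2\circ\psi=\psi\circ f_1$. Then this isomorphism induces an entropy-preserving bijection from the set of non-atomic fair measures of $(X_1,f_1)$ onto the set of non-atomic fair measures of $(X_2,f_2)$ (given by restricting a measure to $X_1\setminus N_1$, pushing it forward by $\psi$, and regarding the result as a measure on $X_2$ that vanishes on $N_2$). Moreover, the two systems have the same fair entropy: $h_{\mathrm{fair}}(f_1)=h_{\mathrm{fair}}(f_2)$.
   Context: Systems: a system $(X,f)$ consists of a Polish space $X$ with its Borel $\sigma$-algebra and a surjection $f:X\to X$ for which there is a countable measurable partition $\mathcal X=\{X_i\}$ of $X$ such that each $f(X_i)$ is measurable and each restriction $f|_{X_i}:X_i\to f(X_i)$ is a measurable isomorphism (images and preimages of measurable sets are measurable). Let $\mathcal A$ be the common refinement of the partitions $\{f(X_i),X\setminus f(X_i)\}$, $i=1,2,\dots$; it is a countable measurable partition. For a set $B$ contained in an element of $\mathcal A$ (written $B\prec\mathcal A$) put $p(B)=\{i:B\subset f(X_i)\}$ and $c(B)=\#p(B)\in\{1,2,\dots,\infty\}$. Fair measure: an $f$-invariant Borel probability measure $\mu$ on $X$ is fair if each measurable $B\prec\mathcal A$ satisfies $\mu(X_i\cap f^{-1}(B))=\mu(B)/c(B)$ for all $i\in p(B)$ (with $\mu(B)/\infty=0$). This does not depend on the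 choice of $\mathcal X$. Fair entropy: $h_{\mathrm{fair}}(f)=\sup\{h_\mu(f):\mu \text{ a fair measure for } f\}$, where $h_\mu(f)$ is the measure-theoretic (Kolmogorov–Sinai) entropy and the supremum over the empty set is taken to be $0$. A set $B\subset X$ is totally invariant if $f^{-1}(B)=B$. Two systems $(X_1,f_1)$, $(X_2,f_2)$ are isomorphic modulo countable invariant sets if there exist totally invariant countable sets $N_1\subset X_1$, $N_2\subset X_2$ and a bijection $\psi:X_1\setminus N_1\to X_2\setminus N_2$, bimeasurable with respect to the Borel $\sigma$-algebras, such that $f_2\circ\psi=\psi\circ f_1$. A measure is non-atomic if every point has measure zero. *)

theory Defs
  imports "HOL-Probability.Probability"
begin

definition measurable_iso :: "('a::topological_space \<Rightarrow> 'b::topological_space) \<Rightarrow> 'a set \<Rightarrow> 'b set \<Rightarrow> bool" where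
  "measurable_iso g A B \<longleftrightarrow> bij_betw g A B
     \<and> (\<forall>E \<in> sets (restrict_space borel A). g ` E \<in> sets (restrict_space borel B))
     \<and> (\<forall>E \<in> sets (restrict_space borel B). A \<inter> g -` E \<in> sets (restrict_space borel A))"

definition iso_partition :: "('a::polish_space \<Rightarrow> 'a) \<Rightarrow> 'a set set \<Rightarrow> bool" where
  "iso_partition f P \<longleftrightarrow> countable P \<and> partition_on UNIV P \<and> P \<subseteq> sets borel
     \<and> (\<forall>A\<in>P. f ` A \<in> sets borel \<and> measurable_iso f A (f ` A))"

definition is_system :: "('a::polish_space \<Rightarrow> 'a) \<Rightarrow> bool" where
  "is_system f \<longleftrightarrow> surj f \<and> (\<exists>P. iso_partition f P)"

text \<open>The common refinement of the partitions \<open>{f ` A, - f ` A}\<close>, \<open>A \<in> P\<close>; a cell is given by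
  the set \<open>S\<close> of those \<open>A \<in> P\<close> whose image contains it.\<close>

definition image_refinement :: "('a \<Rightarrow> 'a) \<Rightarrow> 'a set set \<Rightarrow> 'a set set" where
  "image_refinement f P = (\<lambda>S. (\<Inter>A\<in>S. f ` A) \<inter> (\<Inter>A\<in>P - S. - f ` A)) ` Pow P - {{}}"

definition branches :: "('a \<Rightarrow> 'a) \<Rightarrow> 'a set set \<Rightarrow> 'a set \<Rightarrow> 'a set set" where
  "branches f P B = {A\<in>P. B \<subseteq> f ` A}"

definition branch_count :: "('a \<Rightarrow> 'a) \<Rightarrow> 'a set set \<Rightarrow> 'a set \<Rightarrow> ennreal" where
  "branch_count f P B = (if finite (branches f P B) then of_nat (card (branches f P B)) else \<infinity>)"

definition invariant_prob :: "('a::polish_space \<Rightarrow> 'a) \<Rightarrow> 'a measure \<Rightarrow> bool" where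
  "invariant_prob f \<mu> \<longleftrightarrow> prob_space \<mu> \<and> sets \<mu> = sets borel
     \<and> (\<forall>B\<in>sets borel. emeasure \<mu> (f -` B) = emeasure \<mu> B)"

text \<open>On \<open>ennreal\<close>, \<open>x / \<infinity> = 0\<close>.\<close>

definition fair_wrt :: "('a::polish_space \<Rightarrow> 'a) \<Rightarrow> 'a set set \<Rightarrow> 'a measure \<Rightarrow> bool" where
  "fair_wrt f P \<mu> \<longleftrightarrow> (\<forall>B\<in>sets borel. (\<exists>C\<in>image_refinement f P. B \<subseteq> C) \<longrightarrow>
     (\<forall>A\<in>branches f P B. emeasure \<mu> (A \<inter> f -` B) = emeasure \<mu> B / branch_count f P B))"

text \<open>Fairness is meant to be independent of the partition, and it is so among the partitions \<open>P\<close>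
  whose \<open>image_refinement\<close> is countable; every system has such a partition (split \<open>X\<close> according
  to the number of preimages of \<open>f x\<close> and the rank of \<open>x\<close> among them). For an infinite \<open>P\<close> the
  refinement can be uncountable, and then the condition for this \<open>P\<close> alone may be too weak, but
  it still follows from the condition for a partition with countable refinement. Hence quantifying
  over all partitions gives the partition-independent notion.\<close>

definition fair_measure :: "('a::polish_space \<Rightarrow> 'a) \<Rightarrow> 'a measure \<Rightarrow> bool" where
  "fair_measure f \<mu> \<longleftrightarrow> invariant_prob f \<mu> \<and> (\<forall>P. iso_partition f P \<longrightarrow> fair_wrt f P \<mu>)"

definition non_atomic :: "'a measure \<Rightarrow> bool" where
  "non_atomic \<mu> \<longleftrightarrow> (\<forall>x\<in>space \<mu>. emeasure \<mu> {x} = 0)"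

definition nonatomic_fair_measures :: "('a::polish_space \<Rightarrow> 'a) \<Rightarrow> 'a measure set" where
  "nonatomic_fair_measures f = {\<mu>. fair_measure f \<mu> \<and> non_atomic \<mu>}"

definition finite_meas_partition :: "'a measure \<Rightarrow> 'a set set \<Rightarrow> bool" where
  "finite_meas_partition \<mu> \<xi> \<longleftrightarrow> finite \<xi> \<and> partition_on (space \<mu>) \<xi> \<and> \<xi> \<subseteq> sets \<mu>"

text \<open>Natural logarithm; \<open>0 * ln 0 = 0\<close>.\<close>

definition partition_entropy :: "'a measure \<Rightarrow> 'a set set \<Rightarrow> real" where
  "partition_entropy \<mu> \<xi> = - (\<Sum>A\<in>\<xi>. measure \<mu> A * ln (measure \<mu> A))"

text \<open>The join of the partitions \<open>(f ^^ i) -` \<xi>\<close> for \<open>i < n\<close>.\<close>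

definition iterated_join :: "'a measure \<Rightarrow> ('a \<Rightarrow> 'a) \<Rightarrow> 'a set set \<Rightarrow> nat \<Rightarrow> 'a set set" where
  "iterated_join \<mu> f \<xi> n =
     {{x \<in> space \<mu>. \<forall>i<n. (f ^^ i) x \<in> A i} | A. \<forall>i<n. A i \<in> \<xi>} - {{}}"

text \<open>For invariant \<open>\<mu>\<close> the sequence converges (by subadditivity); \<open>limsup\<close> is its limit.\<close>

definition entropy_wrt :: "'a measure \<Rightarrow> ('a \<Rightarrow> 'a) \<Rightarrow> 'a set set \<Rightarrow> ennreal" where
  "entropy_wrt \<mu> f \<xi> =
     limsup (\<lambda>n. ennreal (partition_entropy \<mu> (iterated_join \<mu> f \<xi> n) / real n))"

definition ks_entropy :: "'a measure \<Rightarrow> ('a \<Rightarrow> 'a) \<Rightarrow> ennreal" where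
  "ks_entropy \<mu> f = (SUP \<xi>\<in>{\<xi>. finite_meas_partition \<mu> \<xi>}. entropy_wrt \<mu> f \<xi>)"

text \<open>In \<open>ennreal\<close> the supremum of the empty set is \<open>0\<close>.\<close>

definition fair_entropy :: "('a::polish_space \<Rightarrow> 'a) \<Rightarrow> ennreal" where
  "fair_entropy f = (SUP \<mu>\<in>{\<mu>. fair_measure f \<mu>}. ks_entropy \<mu> f)"

definition totally_invariant :: "('a \<Rightarrow> 'a) \<Rightarrow> 'a set \<Rightarrow> bool" where
  "totally_invariant f N \<longleftrightarrow> f -` N = N"

definition iso_mod_countable ::
  "('a::polish_space \<Rightarrow> 'a) \<Rightarrow> 'a set \<Rightarrow> ('b::polish_space \<Rightarrow> 'b) \<Rightarrow> 'b set \<Rightarrow> ('a \<Rightarrow> 'b) \<Rightarrow> bool" where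
  "iso_mod_countable f1 N1 f2 N2 \<psi> \<longleftrightarrow>
     countable N1 \<and> totally_invariant f1 N1 \<and> countable N2 \<and> totally_invariant f2 N2
     \<and> measurable_iso \<psi> (- N1) (- N2) \<and> (\<forall>x\<in>- N1. f2 (\<psi> x) = \<psi> (f1 x))"

text \<open>Since \<open>\<psi>\<close> maps \<open>- N\<close> into the complement of the exceptional set of the target system, the
  resulting Borel measure vanishes on that set.\<close>

definition transfer_measure ::
  "('a::polish_space \<Rightarrow> 'b::polish_space) \<Rightarrow> 'a set \<Rightarrow> 'a measure \<Rightarrow> 'b measure" where
  "transfer_measure \<psi> N \<mu> = distr (restrict_space \<mu> (- N)) borel \<psi>"

end

theory Submission imports Defs begin

text \<open>
  Pulling sets back along \<open>\<psi>\<close> translates everything that defines a fair measure from the second system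
  to the first. An admissible partition \<open>P\<close> for \<open>f2\<close> pulls back to one for \<open>f1\<close> once the points of the
  countable set \<open>N1\<close> are added as singleton cells (\<open>iso_partition_pull\<close>). Since \<open>N1\<close> is totally
  invariant, the images of these singletons miss every pulled back set, so a set that is not pulled back
  to the empty set keeps its branches and their number (\<open>pull_refinement_cell\<close>). Hence fairness is
  transferred (\<open>fair_measure_transfer\<close>) as soon as the measure does not charge \<open>N1\<close>. Non-atomic measures
  never charge a countable set, and transferring back along the inverse of \<open>\<psi>\<close> undoes the transfer;
  this gives the bijection. Each of the two transfers makes its target a factor of its source up to a
  null set, and entropy does not increase under factors (\<open>ks_entropy_factor_le\<close>), so entropy is preserved.

  A fair measure with atoms may charge \<open>N1\<close>, and fair entropy is a supremum over these as well. It remains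
  to see that they do not affect the supremum (\<open>fair_entropy_eq_nonatomic\<close>). Let \<open>D\<close> be the countable set
  of atoms of an invariant \<open>\<mu>\<close>. The mass of an atom does not decrease along its orbit, so \<open>D \<subseteq> f -` D\<close>;
  both sets have the same measure, hence they agree up to a null set, and \<open>\<mu>\<close> conditioned on \<open>- D\<close> is again
  invariant and fair. Its entropy is at least that of \<open>\<mu>\<close> (\<open>entropy_wrt_le_off_countable\<close>). Indeed \<open>D\<close> splits
  into a finite set, which meets a bounded number of itinerary cells of every length \<open>n\<close>, and a remainder of
  arbitrarily small mass \<open>\<delta>\<close>, which contributes at most \<open>\<delta> * n * ln k + 1\<close> for a partition into \<open>k\<close>
  sets. If \<open>\<mu>\<close> lives on its atoms the same estimate shows that its entropy is \<open>0\<close>, the value of the empty supremum.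
\<close>

section \<open>Systems and Borel sets\<close>

lemma countable_borel_set:
  fixes N :: "'a::polish_space set"
  assumes "countable N"
  shows "N \<in> sets borel"
  by (rule sets.countable[OF _ assms]) simp

lemma measurable_iso_borel_iff:
  assumes "A \<in> sets borel" and "B \<in> sets borel"
  shows "measurable_iso g A B \<longleftrightarrow> bij_betw g A B
     \<and> (\<forall>E\<in>sets borel. E \<subseteq> A \<longrightarrow> g ` E \<in> sets borel)
     \<and> (\<forall>E\<in>sets borel. E \<subseteq> B \<longrightarrow> A \<inter> g -` E \<in> sets borel)"
proof -
  have *: "E \<in> sets (restrict_space borel A) \<longleftrightarrow> E \<subseteq> A \<and> E \<in> sets borel"
    "E' \<in> sets (restrict_space borel B) \<longleftrightarrow> E' \<subseteq> B \<and> E' \<in> sets borel" for E E'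
    using assms by (simp_all add: sets_restrict_space_iff)
  have "g ` E \<subseteq> B" if "bij_betw g A B" "E \<subseteq> A" for E
    using that by (auto simp: bij_betw_def)
  then show ?thesis
    unfolding measurable_iso_def Ball_def * by (intro conj_cong refl) auto
qed

lemma measurable_iso_inv_into:
  assumes iso: "measurable_iso g A B" and A: "A \<in> sets borel" and B: "B \<in> sets borel"
  shows "measurable_iso (inv_into A g) B A"
proof -
  have bij: "bij_betw g A B"
    and img: "\<And>E. E \<in> sets borel \<Longrightarrow> E \<subseteq> A \<Longrightarrow> g ` E \<in> sets borel"
    and pre: "\<And>E. E \<in> sets borel \<Longrightarrow> E \<subseteq> B \<Longrightarrow> A \<inter> g -` E \<in> sets borel"
    using iso unfolding measurable_iso_borel_iff[OF A B] by auto
  have inj: "inj_on g A" and gA: "g ` A = B"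
    using bij by (auto simp: bij_betw_def)
  have inv: "inv_into A g (g x) = x" if "x \<in> A" for x
    using inj that by simp
  have 1: "inv_into A g ` E = A \<inter> g -` E" if "E \<subseteq> B" for E
  proof
    show "inv_into A g ` E \<subseteq> A \<inter> g -` E"
      using that gA by (auto simp: inv_into_into f_inv_into_f)
    show "A \<inter> g -` E \<subseteq> inv_into A g ` E"
      using inv by (auto intro!: image_eqI[of _ _ "g _"])
  qed
  have 2: "B \<inter> inv_into A g -` E = g ` E" if "E \<subseteq> A" for E
    using that inv gA[symmetric] by auto
  show ?thesis
    unfolding measurable_iso_borel_iff[OF B A]
    using bij_betw_inv_into[OF bij] img pre 1 2 by auto
qed

text \<open>The preimage of a Borel set is assembled from countably many branches, and each branch is a Borel isomorphism.\<close>

lemma iso_partition_borel_measurable: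
  assumes "iso_partition f P"
  shows "f \<in> borel_measurable borel"
proof (rule measurableI)
  fix B :: "'a set" assume B: "B \<in> sets borel"
  have P: "countable P" "\<Union>P = UNIV" "P \<subseteq> sets borel"
    using assms by (auto simp: iso_partition_def partition_on_def)
  have "A \<inter> f -` (B \<inter> f ` A) \<in> sets borel" if "A \<in> P" for A
  proof -
    have A: "A \<in> sets borel" "f ` A \<in> sets borel" and "measurable_iso f A (f ` A)"
      using assms that by (auto simp: iso_partition_def)
    then show ?thesis
      using sets.Int[OF B A(2)] unfolding measurable_iso_borel_iff[OF A]
      by (meson inf_le2)
  qed
  then have "(\<Union>A\<in>P. A \<inter> f -` (B \<inter> f ` A)) \<in> sets borel"
    using P by (intro sets.countable_UN') auto
  also have "(\<Union>A\<in>P. A \<inter> f -` (B \<inter> f ` A)) = f -` B \<inter> space borel"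
  proof (intro set_eqI iffI)
    fix x assume "x \<in> f -` B \<inter> space borel"
    moreover obtain A where "A \<in> P" "x \<in> A" using P(2) by (metis UNIV_I UnionE)
    ultimately show "x \<in> (\<Union>A\<in>P. A \<inter> f -` (B \<inter> f ` A))" by auto
  qed auto
  finally show "f -` B \<inter> space borel \<in> sets borel" .
qed simp

lemma system_borel_measurable: "is_system f \<Longrightarrow> f \<in> borel_measurable borel"
  by (auto simp: is_system_def intro: iso_partition_borel_measurable)

text \<open>Fairness is tested on sets inside a cell of the refinement; this form of the condition mentions only
  the images of the partition sets, which is what \<open>\<psi>\<close> transports.\<close>

lemma subset_refinement_cell_iff:
  assumes "B \<noteq> {}"
  shows "(\<exists>C\<in>image_refinement f P. B \<subseteq> C) \<longleftrightarrow> (\<forall>A\<in>P. B \<subseteq> f ` A \<or> B \<inter> f ` A = {})"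
proof
  assume "\<exists>C\<in>image_refinement f P. B \<subseteq> C"
  then obtain S where S: "B \<subseteq> (\<Inter>A\<in>S. f ` A) \<inter> (\<Inter>A\<in>P - S. - f ` A)"
    unfolding image_refinement_def by (elim bexE DiffE imageE) simp
  then have "B \<subseteq> f ` A" if "A \<in> S" for A
    using that by blast
  moreover have "B \<inter> f ` A = {}" if "A \<in> P - S" for A
    using S that by blast
  ultimately show "\<forall>A\<in>P. B \<subseteq> f ` A \<or> B \<inter> f ` A = {}"
    by blast
next
  assume *: "\<forall>A\<in>P. B \<subseteq> f ` A \<or> B \<inter> f ` A = {}"
  define S where "S = {A\<in>P. B \<subseteq> f ` A}"
  have "B \<subseteq> (\<Inter>A\<in>S. f ` A) \<inter> (\<Inter>A\<in>P - S. - f ` A)"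
    using * unfolding S_def by blast
  moreover have "(\<Inter>A\<in>S. f ` A) \<inter> (\<Inter>A\<in>P - S. - f ` A) \<in> image_refinement f P"
  proof -
    have "S \<in> Pow P" by (auto simp: S_def)
    moreover have "(\<Inter>A\<in>S. f ` A) \<inter> (\<Inter>A\<in>P - S. - f ` A) \<noteq> {}"
      using \<open>B \<noteq> {}\<close> \<open>B \<subseteq> (\<Inter>A\<in>S. f ` A) \<inter> (\<Inter>A\<in>P - S. - f ` A)\<close> by blast
    ultimately show ?thesis unfolding image_refinement_def by blast
  qed
  ultimately show "\<exists>C\<in>image_refinement f P. B \<subseteq> C" by blast
qed

lemma borel_vimage:
  assumes "f \<in> borel_measurable borel" and "B \<in> sets borel"
  shows "f -` B \<in> sets borel"
  using measurable_sets[OF assms] by simp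

lemma non_atomic_countable_null:
  fixes \<mu> :: "'a::polish_space measure"
  assumes "sets \<mu> = sets borel" and "non_atomic \<mu>" and "countable N"
  shows "emeasure \<mu> N = 0"
proof -
  have "(\<Union>x\<in>N. {x}) \<in> null_sets \<mu>"
    using assms by (intro null_sets_UN') (auto simp: non_atomic_def null_sets_def sets_eq_imp_space_eq)
  then show ?thesis by auto
qed

section \<open>Transfer along an isomorphism modulo countable invariant sets\<close>

text \<open>The hypotheses are symmetric in the two systems (see \<open>inverse_iso\<close> below), so every result about the
  transfer along \<open>\<psi>\<close> also holds for the transfer back.\<close>

locale borel_iso_mod_countable =
  fixes f1 :: "'a::polish_space \<Rightarrow> 'a" and N1 :: "'a set"
    and f2 :: "'b::polish_space \<Rightarrow> 'b" and N2 :: "'b set" and \<psi> :: "'a \<Rightarrow> 'b"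
  assumes iso: "iso_mod_countable f1 N1 f2 N2 \<psi>"
    and f1_measurable: "f1 \<in> borel_measurable borel"
    and f2_measurable: "f2 \<in> borel_measurable borel"
begin

text \<open>On \<open>N1\<close> the values of \<open>\<psi>\<close> are arbitrary, so plain preimages under \<open>\<psi>\<close> have no meaning there.\<close>

definition pull :: "'b set \<Rightarrow> 'a set" where
  "pull B = \<psi> -` B - N1"

lemma N_borel: "N1 \<in> sets borel" "N2 \<in> sets borel"
  using iso by (auto simp: iso_mod_countable_def countable_borel_set)

lemma N1_iff: "f1 x \<in> N1 \<longleftrightarrow> x \<in> N1" and N2_iff: "f2 y \<in> N2 \<longleftrightarrow> y \<in> N2"
  using iso unfolding iso_mod_countable_def totally_invariant_def vimage_def by blast+

lemma bij: "bij_betw \<psi> (- N1) (- N2)"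
  using iso by (simp add: iso_mod_countable_def measurable_iso_def)

lemma psi_notin: "x \<notin> N1 \<Longrightarrow> \<psi> x \<notin> N2"
  using bij by (auto simp: bij_betw_def)

lemma psi_eq_iff: "x \<notin> N1 \<Longrightarrow> x' \<notin> N1 \<Longrightarrow> \<psi> x = \<psi> x' \<longleftrightarrow> x = x'"
  using bij by (auto simp: bij_betw_def inj_on_def)

lemma psi_surj:
  assumes "y \<notin> N2"
  obtains x where "x \<notin> N1" and "y = \<psi> x"
  using bij assms by (auto simp: bij_betw_def)

lemma conjugacy: "x \<notin> N1 \<Longrightarrow> f2 (\<psi> x) = \<psi> (f1 x)"
  using iso by (simp add: iso_mod_countable_def)

lemma conjugacy_funpow: "x \<notin> N1 \<Longrightarrow> (f1 ^^ n) x \<notin> N1 \<and> (f2 ^^ n) (\<psi> x) = \<psi> ((f1 ^^ n) x)"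
  by (induction n) (auto simp: N1_iff conjugacy)

lemma image_borel:
  assumes "E \<in> sets borel" "E \<inter> N1 = {}"
  shows "\<psi> ` E \<in> sets borel"
proof -
  have "measurable_iso \<psi> (- N1) (- N2)"
    using iso by (simp add: iso_mod_countable_def)
  moreover have "- N1 \<in> sets borel" "- N2 \<in> sets borel"
    using N_borel by auto
  moreover have "E \<subseteq> - N1" using assms by auto
  ultimately show ?thesis
    using assms(1) by (simp add: measurable_iso_borel_iff)
qed

lemma pull_borel:
  assumes "B \<in> sets borel"
  shows "pull B \<in> sets borel"
proof -
  have "measurable_iso \<psi> (- N1) (- N2)"
    using iso by (simp add: iso_mod_countable_def)
  moreover have "- N1 \<in> sets borel" "- N2 \<in> sets borel" "B - N2 \<in> sets borel"
    using N_borel assms by auto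
  moreover have "B - N2 \<subseteq> - N2" by auto
  ultimately have "- N1 \<inter> \<psi> -` (B - N2) \<in> sets borel"
    by (simp add: measurable_iso_borel_iff)
  also have "- N1 \<inter> \<psi> -` (B - N2) = pull B"
    using psi_notin by (auto simp: pull_def)
  finally show ?thesis .
qed

lemma pull_vimage: "pull (f2 -` B) = f1 -` pull B"
  by (auto simp: pull_def N1_iff conjugacy)

text \<open>A point of \<open>- N1\<close> that \<open>\<psi>\<close> sends to \<open>f2 y\<close> forces \<open>y\<close> to lie outside \<open>N2\<close>, by total invariance; hence
  \<open>y\<close> itself comes from \<open>- N1\<close>.\<close>

lemma pull_image: "f1 ` pull A = pull (f2 ` A)"
proof
  show "f1 ` pull A \<subseteq> pull (f2 ` A)"
    by (auto simp: pull_def N1_iff conjugacy[symmetric])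
  show "pull (f2 ` A) \<subseteq> f1 ` pull A"
  proof
    fix x assume "x \<in> pull (f2 ` A)"
    then obtain y where y: "y \<in> A" "\<psi> x = f2 y" and x: "x \<notin> N1"
      by (auto simp: pull_def)
    have "y \<notin> N2" using psi_notin[OF x] y N2_iff by simp
    then obtain z where z: "z \<notin> N1" "y = \<psi> z" using psi_surj by blast
    then have "\<psi> x = \<psi> (f1 z)" using y conjugacy by simp
    then have "x = f1 z" using x z psi_eq_iff N1_iff by blast
    then show "x \<in> f1 ` pull A" using z y by (auto simp: pull_def)
  qed
qed

lemma pull_Int: "pull (A \<inter> B) = pull A \<inter> pull B"
  by (auto simp: pull_def)

lemma transfer_psi_measurable:
  assumes "sets \<mu> = sets borel"
  shows "\<psi> \<in> measurable (restrict_space \<mu> (- N1)) borel"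
proof (rule measurableI)
  fix B :: "'b set" assume "B \<in> sets borel"
  have sp: "space \<mu> = UNIV" using sets_eq_imp_space_eq[OF assms] by simp
  have "\<psi> -` B \<inter> space (restrict_space \<mu> (- N1)) = pull B"
    by (auto simp: space_restrict_space sp pull_def)
  then show "\<psi> -` B \<inter> space (restrict_space \<mu> (- N1)) \<in> sets (restrict_space \<mu> (- N1))"
    using pull_borel[OF \<open>B \<in> sets borel\<close>] assms N_borel
    by (auto simp: sets_restrict_space_iff sp pull_def)
qed simp

lemma sets_transfer [simp]: "sets (transfer_measure \<psi> N1 \<mu>) = sets borel"
  by (simp add: transfer_measure_def)

lemma space_transfer [simp]: "space (transfer_measure \<psi> N1 \<mu>) = UNIV"
  by (simp add: transfer_measure_def)

lemma emeasure_transfer: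
  assumes "sets \<mu> = sets borel" and "B \<in> sets borel"
  shows "emeasure (transfer_measure \<psi> N1 \<mu>) B = emeasure \<mu> (pull B)"
proof -
  have sp: "space \<mu> = UNIV" using sets_eq_imp_space_eq[OF assms(1)] by simp
  have "emeasure (transfer_measure \<psi> N1 \<mu>) B
      = emeasure (restrict_space \<mu> (- N1)) (\<psi> -` B \<inter> space (restrict_space \<mu> (- N1)))"
    unfolding transfer_measure_def
    by (rule emeasure_distr[OF transfer_psi_measurable[OF assms(1)] assms(2)])
  also have "\<psi> -` B \<inter> space (restrict_space \<mu> (- N1)) = pull B"
    by (auto simp: space_restrict_space sp pull_def)
  also have "emeasure (restrict_space \<mu> (- N1)) (pull B) = emeasure \<mu> (pull B)"
    by (rule emeasure_restrict_space) (use assms N_borel in \<open>auto simp: sp pull_def\<close>)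
  finally show ?thesis .
qed

lemma inverse_iso: "borel_iso_mod_countable f2 N2 f1 N1 (inv_into (- N1) \<psi>)"
proof
  have "inv_into (- N1) \<psi> (f2 y) = f1 (inv_into (- N1) \<psi> y)" if y: "y \<notin> N2" for y
  proof -
    obtain x where x: "x \<notin> N1" "y = \<psi> x" using psi_surj[OF y] .
    then show ?thesis
      using bij N1_iff conjugacy by (simp add: bij_betw_def inv_into_f_f)
  qed
  moreover have "measurable_iso (inv_into (- N1) \<psi>) (- N2) (- N1)"
    using iso N_borel by (intro measurable_iso_inv_into) (auto simp: iso_mod_countable_def)
  ultimately show "iso_mod_countable f2 N2 f1 N1 (inv_into (- N1) \<psi>)"
    using iso by (simp add: iso_mod_countable_def)
qed (fact f2_measurable f1_measurable)+

lemma transfer_inverse: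
  assumes "sets \<mu> = sets borel" and "emeasure \<mu> N1 = 0"
  shows "transfer_measure (inv_into (- N1) \<psi>) N2 (transfer_measure \<psi> N1 \<mu>) = \<mu>"
proof (rule measure_eqI)
  interpret inv: borel_iso_mod_countable f2 N2 f1 N1 "inv_into (- N1) \<psi>"
    by (rule inverse_iso)
  show "sets (transfer_measure (inv_into (- N1) \<psi>) N2 (transfer_measure \<psi> N1 \<mu>)) = sets \<mu>"
    using assms by simp
  fix B assume "B \<in> sets (transfer_measure (inv_into (- N1) \<psi>) N2 (transfer_measure \<psi> N1 \<mu>))"
  then have B: "B \<in> sets borel" by simp
  have "pull (inv.pull B) = B - N1"
    using psi_notin bij by (auto simp: pull_def inv.pull_def bij_betw_def inv_into_f_f)
  then have "emeasure (transfer_measure (inv_into (- N1) \<psi>) N2 (transfer_measure \<psi> N1 \<mu>)) B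
      = emeasure \<mu> (B - N1)"
    using assms B by (simp add: inv.emeasure_transfer emeasure_transfer inv.pull_borel)
  also have "\<dots> = emeasure \<mu> B"
    using assms B N_borel by (intro emeasure_Diff_null_set) (auto simp: null_sets_def)
  finally show "emeasure (transfer_measure (inv_into (- N1) \<psi>) N2 (transfer_measure \<psi> N1 \<mu>)) B
      = emeasure \<mu> B" .
qed

lemma non_atomic_transfer:
  assumes "sets \<mu> = sets borel" and "non_atomic \<mu>"
  shows "non_atomic (transfer_measure \<psi> N1 \<mu>)"
  unfolding non_atomic_def
proof
  fix y
  have "countable (pull {y})"
  proof (cases "\<exists>x. x \<in> pull {y}")
    case True
    then obtain x where "x \<in> pull {y}" ..
    then have "pull {y} = {x}" using psi_eq_iff by (auto simp: pull_def)
    then show ?thesis by simp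
  next
    case False
    then have "pull {y} = {}" by blast
    then show ?thesis by simp
  qed
  then show "emeasure (transfer_measure \<psi> N1 \<mu>) {y} = 0"
    using assms by (simp add: emeasure_transfer non_atomic_countable_null)
qed

lemma invariant_prob_transfer:
  assumes inv: "invariant_prob f1 \<mu>" and null: "emeasure \<mu> N1 = 0"
  shows "invariant_prob f2 (transfer_measure \<psi> N1 \<mu>)"
proof -
  have sets: "sets \<mu> = sets borel" and "prob_space \<mu>"
    using inv by (auto simp: invariant_prob_def)
  have sp: "space \<mu> = UNIV" using sets_eq_imp_space_eq[OF sets] by simp
  have "emeasure \<mu> (pull UNIV) = emeasure \<mu> (UNIV - N1)"
    by (simp add: pull_def)
  also have "\<dots> = emeasure \<mu> UNIV"
    using null sets N_borel by (intro emeasure_Diff_null_set) (auto simp: null_sets_def)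
  also have "\<dots> = 1"
    using prob_space.emeasure_space_1[OF \<open>prob_space \<mu>\<close>] sp by simp
  finally have "prob_space (transfer_measure \<psi> N1 \<mu>)"
    by (intro prob_spaceI) (simp add: emeasure_transfer sets)
  moreover have "emeasure (transfer_measure \<psi> N1 \<mu>) (f2 -` B) = emeasure (transfer_measure \<psi> N1 \<mu>) B"
    if "B \<in> sets borel" for B
    using that inv borel_vimage[OF f2_measurable that]
    by (simp add: emeasure_transfer sets pull_vimage pull_borel invariant_prob_def)
  ultimately show ?thesis by (simp add: invariant_prob_def)
qed

text \<open>The singletons are needed to cover \<open>N1\<close>; there are countably many, and \<open>f1\<close> is trivially an isomorphism
  from each to its image. Sets of \<open>P\<close> inside \<open>N2\<close> are pulled back to the empty set, which is removed.\<close>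

definition pull_partition :: "'b set set \<Rightarrow> 'a set set" where
  "pull_partition P = (pull ` P \<union> (\<lambda>x. {x}) ` N1) - {{}}"

lemma iso_partition_pull:
  assumes P: "iso_partition f2 P"
  shows "iso_partition f1 (pull_partition P)"
proof -
  have cP: "countable P" and UP: "\<Union>P = UNIV" and dP: "disjoint P" and bP: "P \<subseteq> sets borel"
    and fP: "\<And>A. A \<in> P \<Longrightarrow> f2 ` A \<in> sets borel"
    and mP: "\<And>A. A \<in> P \<Longrightarrow> measurable_iso f2 A (f2 ` A)"
    using P by (auto simp: iso_partition_def partition_on_def)
  have c1: "countable N1" using iso by (simp add: iso_mod_countable_def)
  have part: "partition_on UNIV (pull_partition P)"
  proof (rule partition_onI)
    show "\<Union>(pull_partition P) = UNIV"
    proof -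
      have "x \<in> \<Union>(pull_partition P)" for x
      proof (cases "x \<in> N1")
        case True then show ?thesis by (auto simp: pull_partition_def)
      next
        case False
        obtain A where "A \<in> P" "\<psi> x \<in> A" using UP by (metis UNIV_I UnionE)
        then have "x \<in> pull A" "pull A \<in> pull_partition P"
          using False by (auto simp: pull_partition_def pull_def)
        then show ?thesis by blast
      qed
      then show ?thesis by auto
    qed
    show "{} \<notin> pull_partition P" by (simp add: pull_partition_def)
    have unique: "A = A'" if "A \<in> P" "A' \<in> P" "x \<in> A" "x \<in> A'" for A A' x
      using dP that by (auto simp: disjoint_def)
    have "p = q" if p: "p \<in> pull_partition P" and q: "q \<in> pull_partition P" and x: "x \<in> p" "x \<in> q" for p q x
    proof (cases "x \<in> N1")
      case True
      then show ?thesis using p q x by (auto simp: pull_partition_def pull_def)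
    next
      case False
      obtain A where A: "A \<in> P" "p = pull A"
        using p x False by (auto simp: pull_partition_def)
      obtain A' where A': "A' \<in> P" "q = pull A'"
        using q x False by (auto simp: pull_partition_def)
      have "\<psi> x \<in> A" "\<psi> x \<in> A'" using x A A' by (auto simp: pull_def)
      then have "A = A'" using A A' unique by blast
      then show ?thesis using A A' by simp
    qed
    then show "disjnt p q" if "p \<in> pull_partition P" "q \<in> pull_partition P" "p \<noteq> q" for p q
      using that unfolding disjnt_iff by blast
  qed
  have cell: "A \<in> sets borel \<and> f1 ` A \<in> sets borel \<and> measurable_iso f1 A (f1 ` A)"
    if A: "A \<in> pull_partition P" for A
  proof -
    consider A' where "A' \<in> P" "A = pull A'" | x where "x \<in> N1" "A = {x}"
      using A by (auto simp: pull_partition_def)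
    then show ?thesis
    proof cases
      case 1
      note A' = \<open>A' \<in> P\<close> and A = \<open>A = pull A'\<close>
      have Ab: "A \<in> sets borel" "f1 ` A \<in> sets borel"
        using A' bP fP by (auto simp: A pull_image pull_borel)
      have iso': "bij_betw f2 A' (f2 ` A')"
        "\<And>E. E \<in> sets borel \<Longrightarrow> E \<subseteq> A' \<Longrightarrow> f2 ` E \<in> sets borel"
        using mP[OF A'] A' bP fP by (auto simp: measurable_iso_borel_iff subset_iff)
      have "inj_on f1 A"
      proof (rule inj_onI)
        fix x y assume xy: "x \<in> A" "y \<in> A" "f1 x = f1 y"
        then have n: "x \<notin> N1" "y \<notin> N1" "\<psi> x \<in> A'" "\<psi> y \<in> A'"
          by (auto simp: A pull_def)
        then have "f2 (\<psi> x) = f2 (\<psi> y)" using xy conjugacy by simp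
        then have "\<psi> x = \<psi> y" using iso'(1) n by (auto simp: bij_betw_def inj_on_def)
        then show "x = y" using n psi_eq_iff by blast
      qed
      moreover have "f1 ` E \<in> sets borel" if "E \<in> sets borel" "E \<subseteq> A" for E
      proof -
        have "\<psi> ` E \<in> sets borel" "\<psi> ` E \<subseteq> A'"
          using that image_borel by (auto simp: A pull_def)
        then have "pull (f2 ` \<psi> ` E) \<in> sets borel" using iso' pull_borel by blast
        also have "pull (f2 ` \<psi> ` E) = f1 ` pull (\<psi> ` E)" by (simp add: pull_image)
        also have "pull (\<psi> ` E) = E"
          using that psi_eq_iff by (auto simp: A pull_def)
        finally show ?thesis .
      qed
      moreover have "A \<inter> f1 -` E \<in> sets borel" if "E \<in> sets borel" for E
        using Ab borel_vimage[OF f1_measurable that] by auto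
      ultimately show ?thesis
        using Ab by (simp add: measurable_iso_borel_iff bij_betw_def)
    next
      case 2
      have "E \<in> sets borel \<Longrightarrow> {x} \<inter> f1 -` E \<in> sets borel" for E
        using borel_vimage[OF f1_measurable] by auto
      then show ?thesis
        using 2 by (auto simp: measurable_iso_borel_iff subset_singleton_iff)
    qed
  qed
  show ?thesis
    unfolding iso_partition_def using part cell cP c1
    by (auto simp: pull_partition_def)
qed

text \<open>If \<open>B\<close> lies in a cell for \<open>f2\<close> then \<open>pull B\<close> lies in one for \<open>f1\<close>, with the same branches. The singleton
  sets of the pulled back partition have images inside \<open>N1\<close>, so they are never branches of \<open>pull B\<close>. For the
  other sets, \<open>f2 ` A\<close> either contains \<open>B\<close> or misses it, and as \<open>pull B\<close> is not empty the two alternatives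
  can still be told apart after pulling back.\<close>

lemma pull_refinement_cell:
  assumes P: "iso_partition f2 P" and B: "\<And>A. A \<in> P \<Longrightarrow> B \<subseteq> f2 ` A \<or> B \<inter> f2 ` A = {}"
    and ne: "pull B \<noteq> {}"
  shows "\<exists>C\<in>image_refinement f1 (pull_partition P). pull B \<subseteq> C"
    and "branches f1 (pull_partition P) (pull B) = pull ` branches f2 P B"
    and "inj_on pull (branches f2 P B)"
proof -
  have single: "pull B \<inter> f1 ` {x} = {}" if "x \<in> N1" for x
    using that N1_iff by (auto simp: pull_def)
  have mono: "pull X \<subseteq> pull Y" if "X \<subseteq> Y" for X Y using that by (auto simp: pull_def)
  have sub_iff: "pull B \<subseteq> f1 ` pull A \<longleftrightarrow> B \<subseteq> f2 ` A" if "A \<in> P" for A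
  proof (cases "B \<subseteq> f2 ` A")
    case True
    then show ?thesis using mono by (simp add: pull_image)
  next
    case False
    then have "pull B \<inter> pull (f2 ` A) = pull {}"
      using B[OF that] pull_Int[of B "f2 ` A"] by simp
    also have "pull {} = {}" by (simp add: pull_def)
    finally show ?thesis
      using False ne unfolding pull_image by blast
  qed
  have "pull B \<subseteq> f1 ` A \<or> pull B \<inter> f1 ` A = {}" if A: "A \<in> pull_partition P" for A
  proof -
    consider A' where "A' \<in> P" "A = pull A'" | x where "x \<in> N1" "A = {x}"
      using A by (auto simp: pull_partition_def)
    then show ?thesis
    proof cases
      case 1
      have "pull {} = {}" by (simp add: pull_def)
      then have "pull B \<inter> f1 ` A = {}" if "B \<inter> f2 ` A' = {}"
        using that pull_Int[of B "f2 ` A'"] 1 by (simp add: pull_image)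
      then show ?thesis using B[OF 1(1)] sub_iff[OF 1(1)] 1 by auto
    next
      case 2
      then show ?thesis using single by auto
    qed
  qed
  then show "\<exists>C\<in>image_refinement f1 (pull_partition P). pull B \<subseteq> C"
    using ne by (simp add: subset_refinement_cell_iff)
  have ne': "pull A \<noteq> {}" if "A \<in> branches f2 P B" for A
    using that sub_iff[of A] ne by (auto simp: branches_def)
  show "branches f1 (pull_partition P) (pull B) = pull ` branches f2 P B"
  proof (rule set_eqI)
    fix A
    show "A \<in> branches f1 (pull_partition P) (pull B) \<longleftrightarrow> A \<in> pull ` branches f2 P B"
      using single ne sub_iff ne'
      by (fastforce simp: branches_def pull_partition_def)
  qed
  show "inj_on pull (branches f2 P B)"
  proof (rule inj_onI)
    fix A A' assume A: "A \<in> branches f2 P B" "A' \<in> branches f2 P B" "pull A = pull A'"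
    then obtain x where "x \<in> pull A" "x \<in> pull A'" using ne' by blast
    then have "\<psi> x \<in> A \<inter> A'" by (simp add: pull_def)
    moreover have "disjoint P" "A \<in> P" "A' \<in> P"
      using A P by (auto simp: branches_def iso_partition_def partition_on_def)
    ultimately show "A = A'" unfolding disjoint_def by blast
  qed
qed

text \<open>Both sides of the fairness equation for \<open>A\<close> and \<open>B\<close> are the corresponding sides for \<open>pull A\<close> and
  \<open>pull B\<close>. If \<open>pull B\<close> is empty the branches need not correspond, but then both sides vanish.\<close>

lemma fair_measure_transfer:
  assumes fair: "fair_measure f1 \<mu>" and null: "emeasure \<mu> N1 = 0"
  shows "fair_measure f2 (transfer_measure \<psi> N1 \<mu>)"
proof -
  let ?\<nu> = "transfer_measure \<psi> N1 \<mu>"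
  have sets: "sets \<mu> = sets borel"
    using fair by (auto simp: fair_measure_def invariant_prob_def)
  have "emeasure ?\<nu> (A \<inter> f2 -` B) = emeasure ?\<nu> B / branch_count f2 P B"
    if P: "iso_partition f2 P" and B: "B \<in> sets borel"
      and cell: "\<exists>C\<in>image_refinement f2 P. B \<subseteq> C" and A: "A \<in> branches f2 P B" for P B A
  proof -
    have "A \<in> sets borel" using A P by (auto simp: branches_def iso_partition_def)
    then have AB: "A \<inter> f2 -` B \<in> sets borel"
      using borel_vimage[OF f2_measurable B] by auto
    have eq: "emeasure ?\<nu> (A \<inter> f2 -` B) = emeasure \<mu> (pull A \<inter> f1 -` pull B)"
      using AB by (simp add: emeasure_transfer sets pull_Int pull_vimage)
    show ?thesis
    proof (cases "pull B = {}")
      case True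
      then show ?thesis using eq B by (simp add: emeasure_transfer sets)
    next
      case False
      then have "B \<noteq> {}" by (auto simp: pull_def)
      then have dich: "\<And>A. A \<in> P \<Longrightarrow> B \<subseteq> f2 ` A \<or> B \<inter> f2 ` A = {}"
        using cell by (simp add: subset_refinement_cell_iff)
      note pd = pull_refinement_cell[OF P dich False]
      have "fair_wrt f1 (pull_partition P) \<mu>"
        using fair iso_partition_pull[OF P] by (simp add: fair_measure_def)
      then have "emeasure \<mu> (pull A \<inter> f1 -` pull B)
          = emeasure \<mu> (pull B) / branch_count f1 (pull_partition P) (pull B)"
        using pd A pull_borel[OF B] unfolding fair_wrt_def by blast
      moreover have "branch_count f1 (pull_partition P) (pull B) = branch_count f2 P B"
        using pd by (simp add: branch_count_def finite_image_iff card_image)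
      ultimately show ?thesis using eq B by (simp add: emeasure_transfer sets)
    qed
  qed
  then have "fair_wrt f2 P ?\<nu>" if "iso_partition f2 P" for P
    using that by (simp add: fair_wrt_def)
  then show ?thesis
    using fair null by (simp add: fair_measure_def invariant_prob_transfer)
qed

lemma nonatomic_fair_transfer:
  assumes "\<mu> \<in> nonatomic_fair_measures f1"
  shows "sets \<mu> = sets borel" "emeasure \<mu> N1 = 0"
    "transfer_measure \<psi> N1 \<mu> \<in> nonatomic_fair_measures f2"
proof -
  have fair: "fair_measure f1 \<mu>" and na: "non_atomic \<mu>"
    using assms by (auto simp: nonatomic_fair_measures_def)
  show sets: "sets \<mu> = sets borel"
    using fair by (simp add: fair_measure_def invariant_prob_def)
  show null: "emeasure \<mu> N1 = 0"
    using iso by (intro non_atomic_countable_null sets na) (simp add: iso_mod_countable_def)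
  show "transfer_measure \<psi> N1 \<mu> \<in> nonatomic_fair_measures f2"
    using fair_measure_transfer[OF fair null] non_atomic_transfer[OF sets na]
    by (simp add: nonatomic_fair_measures_def)
qed

lemma bij_betw_transfer:
  "bij_betw (transfer_measure \<psi> N1) (nonatomic_fair_measures f1) (nonatomic_fair_measures f2)"
proof -
  interpret inv: borel_iso_mod_countable f2 N2 f1 N1 "inv_into (- N1) \<psi>"
    by (rule inverse_iso)
  \<comment> \<open>Inverting twice gives back \<open>\<psi>\<close> only on \<open>- N1\<close>, which is all that the transfer looks at.\<close>
  define \<phi> where "\<phi> = inv_into (- N2) (inv_into (- N1) \<psi>)"
  have psi: "\<phi> x = \<psi> x" if "x \<notin> N1" for x
    unfolding \<phi>_def using that bij inv_into_inv_into_eq[of \<psi> "- N1" "- N2" x] by simp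
  have eq: "transfer_measure \<phi> N1 \<mu> = transfer_measure \<psi> N1 \<mu>" for \<mu> :: "'a measure"
    unfolding transfer_measure_def
    by (rule distr_cong) (auto simp: psi space_restrict_space)
  have inverse: "transfer_measure \<psi> N1 (transfer_measure (inv_into (- N1) \<psi>) N2 \<nu>) = \<nu>"
    if "\<nu> \<in> nonatomic_fair_measures f2" for \<nu>
    using inv.transfer_inverse[OF inv.nonatomic_fair_transfer(1,2)[OF that]]
    unfolding \<phi>_def[symmetric] by (simp add: eq)
  show ?thesis
    by (rule bij_betw_byWitness[where f' = "transfer_measure (inv_into (- N1) \<psi>) N2"])
      (use transfer_inverse inverse nonatomic_fair_transfer inv.nonatomic_fair_transfer in auto)
qed

end

section \<open>Entropy as a sum over itineraries\<close>

definition entropy_term :: "real \<Rightarrow> real" where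
  "entropy_term x = - (x * ln x)"

text \<open>The cells of the iterated join, indexed by words over a set of labels of the partition. Indexing by words
  makes the sums for different partitions and different measures comparable term by term, at the price of
  some empty cells.\<close>

definition itinerary_cell :: "('a \<Rightarrow> 'a) \<Rightarrow> ('l \<Rightarrow> 'a set) \<Rightarrow> nat \<Rightarrow> (nat \<Rightarrow> 'l) \<Rightarrow> 'a set" where
  "itinerary_cell f C n w = {x. \<forall>i<n. (f ^^ i) x \<in> C (w i)}"

lemma itinerary_cells_disjoint:
  assumes "disjoint_family_on C L"
  shows "disjoint_family_on (itinerary_cell f C n) ({..<n} \<rightarrow>\<^sub>E L)"
  unfolding disjoint_family_on_def
proof (intro ballI impI)
  fix w w' assume w: "w \<in> {..<n} \<rightarrow>\<^sub>E L" "w' \<in> {..<n} \<rightarrow>\<^sub>E L" "w \<noteq> w'"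
  then obtain i where i: "i < n" "w i \<noteq> w' i"
    by (meson PiE_ext lessThan_iff)
  then have "C (w i) \<inter> C (w' i) = {}"
    using assms w by (auto simp: disjoint_family_on_def PiE_iff)
  then show "itinerary_cell f C n w \<inter> itinerary_cell f C n w' = {}"
    using i(1) by (auto simp: itinerary_cell_def)
qed

text \<open>Disjointness makes the map from words with non-empty cell to cells injective, and the empty cells contribute
  \<open>0 * ln 0 = 0\<close>. Labels with empty \<open>C l\<close> are allowed, which is convenient for preimages of partitions.\<close>

lemma partition_entropy_iterated_join:
  assumes sp: "space \<mu> = UNIV" and fin: "finite L" and dis: "disjoint_family_on C L"
    and xi: "\<xi> = C ` L - {{}}"
  shows "partition_entropy \<mu> (iterated_join \<mu> f \<xi> n)
    = (\<Sum>w\<in>{..<n} \<rightarrow>\<^sub>E L. entropy_term (measure \<mu> (itinerary_cell f C n w)))"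
proof -
  let ?c = "itinerary_cell f C n"
  let ?W = "{..<n} \<rightarrow>\<^sub>E L"
  let ?V = "{w \<in> ?W. ?c w \<noteq> {}}"
  have finW: "finite ?W" using fin by (simp add: finite_PiE)
  have inj: "inj_on ?c ?V"
    using itinerary_cells_disjoint[OF dis, of f n]
    unfolding inj_on_def disjoint_family_on_def by blast
  have img: "?c ` ?V = iterated_join \<mu> f \<xi> n"
  proof
    show "?c ` ?V \<subseteq> iterated_join \<mu> f \<xi> n"
    proof
      fix E assume "E \<in> ?c ` ?V"
      then obtain w where w: "w \<in> ?W" "E = ?c w" "?c w \<noteq> {}" by blast
      then have "\<forall>i<n. C (w i) \<in> \<xi>"
        unfolding xi itinerary_cell_def by (auto simp: PiE_iff)
      then show "E \<in> iterated_join \<mu> f \<xi> n"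
        using w unfolding iterated_join_def itinerary_cell_def sp
        by (auto intro!: exI[of _ "\<lambda>i. C (w i)"])
    qed
    show "iterated_join \<mu> f \<xi> n \<subseteq> ?c ` ?V"
    proof
      fix E assume "E \<in> iterated_join \<mu> f \<xi> n"
      then obtain A where A: "\<forall>i<n. A i \<in> \<xi>" "E = {x. \<forall>i<n. (f ^^ i) x \<in> A i}" "E \<noteq> {}"
        unfolding iterated_join_def sp by auto
      then have "\<forall>i. \<exists>l. i < n \<longrightarrow> l \<in> L \<and> A i = C l"
        unfolding xi by blast
      then obtain v where v: "\<And>i. i < n \<Longrightarrow> v i \<in> L \<and> A i = C (v i)" by metis
      define w where "w = restrict v {..<n}"
      have "w \<in> ?W" "E = ?c w"
        using v A(2) by (auto simp: w_def itinerary_cell_def)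
      then show "E \<in> ?c ` ?V" using A(3) by blast
    qed
  qed
  have "(\<Sum>w\<in>?W. entropy_term (measure \<mu> (?c w))) = (\<Sum>w\<in>?V. entropy_term (measure \<mu> (?c w)))"
    by (rule sum.mono_neutral_right) (use finW in \<open>auto simp: entropy_term_def\<close>)
  also have "\<dots> = (\<Sum>E\<in>iterated_join \<mu> f \<xi> n. entropy_term (measure \<mu> E))"
    unfolding img[symmetric] by (simp add: sum.reindex[OF inj])
  also have "\<dots> = partition_entropy \<mu> (iterated_join \<mu> f \<xi> n)"
    by (simp add: partition_entropy_def entropy_term_def sum_negf)
  finally show ?thesis by simp
qed

lemma funpow_borel_measurable:
  fixes f :: "'a::topological_space \<Rightarrow> 'a"
  assumes "f \<in> borel_measurable borel"
  shows "(f ^^ n) \<in> borel_measurable borel"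
proof (induction n)
  case (Suc n)
  show ?case unfolding funpow.simps by (rule measurable_comp[OF Suc.IH assms])
qed simp

lemma itinerary_cell_borel:
  assumes f: "f \<in> borel_measurable borel" and C: "\<And>l. l \<in> L \<Longrightarrow> C l \<in> sets borel"
    and w: "w \<in> {..<n} \<rightarrow>\<^sub>E L"
  shows "itinerary_cell f C n w \<in> sets borel"
proof -
  have "(f ^^ i) -` C (w i) \<in> sets borel" if "i < n" for i
    using measurable_sets[OF funpow_borel_measurable[OF f], of "C (w i)" i] C w that
    by (auto simp: PiE_iff)
  then have "space borel \<inter> (\<Inter>i\<in>{..<n}. (f ^^ i) -` C (w i)) \<in> sets borel"
    by (cases "n = 0") auto
  also have "space borel \<inter> (\<Inter>i\<in>{..<n}. (f ^^ i) -` C (w i)) = itinerary_cell f C n w"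
    by (auto simp: itinerary_cell_def)
  finally show ?thesis .
qed

text \<open>Entropy does not increase under factors: the preimage under \<open>h\<close> of a partition has itinerary cells of the same
  measure as the original ones, so it has the same entropy.\<close>

lemma ks_entropy_factor_le:
  fixes h :: "'a::polish_space \<Rightarrow> 'b::polish_space"
  assumes \<mu>: "sets \<mu> = sets borel" and \<nu>: "sets \<nu> = sets borel"
    and f: "f \<in> borel_measurable borel" and g: "g \<in> borel_measurable borel"
    and h: "h \<in> borel_measurable borel"
    and image: "\<And>B. B \<in> sets borel \<Longrightarrow> emeasure \<nu> B = emeasure \<mu> (h -` B)"
    and N: "N \<in> null_sets \<mu>"
    and conj: "\<And>n x. x \<notin> N \<Longrightarrow> (g ^^ n) (h x) = h ((f ^^ n) x)"
  shows "ks_entropy \<nu> g \<le> ks_entropy \<mu> f"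
proof -
  have sp: "space \<mu> = UNIV" "space \<nu> = UNIV"
    using sets_eq_imp_space_eq[OF \<mu>] sets_eq_imp_space_eq[OF \<nu>] by auto
  have "entropy_wrt \<nu> g \<xi> \<le> ks_entropy \<mu> f" if \<xi>: "finite_meas_partition \<nu> \<xi>" for \<xi>
  proof -
    define C where "C = (\<lambda>A. h -` A)"
    have fin: "finite \<xi>" and U: "\<Union>\<xi> = UNIV" and dis: "disjoint \<xi>" and ne: "{} \<notin> \<xi>"
      and bor: "\<xi> \<subseteq> sets borel"
      using \<xi> by (auto simp: finite_meas_partition_def partition_on_def sp \<nu>)
    have d1: "disjoint_family_on (\<lambda>A. A) \<xi>" and d2: "disjoint_family_on C \<xi>"
      using dis by (auto simp: disjoint_family_on_def disjoint_def C_def)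
    have Cb: "C A \<in> sets borel" if "A \<in> \<xi>" for A
      using measurable_sets[OF h, of A] that bor by (auto simp: C_def)
    have "partition_on UNIV (C ` \<xi> - {{}})"
    proof (rule partition_onI)
      have "x \<in> \<Union>(C ` \<xi> - {{}})" for x
      proof -
        obtain A where "A \<in> \<xi>" "h x \<in> A" using U by (metis UNIV_I UnionE)
        then have "x \<in> C A" "C A \<in> C ` \<xi> - {{}}" by (auto simp: C_def)
        then show ?thesis by blast
      qed
      then show "\<Union>(C ` \<xi> - {{}}) = UNIV" by blast
      show "disjnt p q" if pq: "p \<in> C ` \<xi> - {{}}" "q \<in> C ` \<xi> - {{}}" "p \<noteq> q" for p q
      proof -
        obtain A A' where A: "A \<in> \<xi>" "p = C A" "A' \<in> \<xi>" "q = C A'" using pq by auto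
        then have "A \<noteq> A'" using pq(3) by auto
        then have "C A \<inter> C A' = {}" using d2 A unfolding disjoint_family_on_def by blast
        then show ?thesis using A by (simp add: disjnt_def)
      qed
    qed simp
    then have fmp: "finite_meas_partition \<mu> (C ` \<xi> - {{}})"
      using fin Cb by (auto simp: finite_meas_partition_def sp \<mu>)
    have cell: "measure \<nu> (itinerary_cell g (\<lambda>A. A) n w) = measure \<mu> (itinerary_cell f C n w)"
      if w: "w \<in> {..<n} \<rightarrow>\<^sub>E \<xi>" for n w
    proof -
      let ?E = "itinerary_cell g (\<lambda>A. A) n w" and ?F = "itinerary_cell f C n w"
      have E: "?E \<in> sets borel" using bor by (intro itinerary_cell_borel[OF g _ w]) auto
      have F: "?F \<in> sets borel" using Cb by (intro itinerary_cell_borel[OF f _ w])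
      have hE: "h -` ?E \<in> sets borel" using measurable_sets[OF h E] by simp
      have "emeasure \<nu> ?E = emeasure \<mu> (h -` ?E)" by (rule image[OF E])
      also have "\<dots> = emeasure \<mu> (h -` ?E - N)"
        using hE N \<mu> by (intro emeasure_Diff_null_set[symmetric]) auto
      also have "h -` ?E - N = ?F - N"
        using conj by (auto simp: itinerary_cell_def C_def)
      also have "emeasure \<mu> (?F - N) = emeasure \<mu> ?F"
        using F N \<mu> by (intro emeasure_Diff_null_set) auto
      finally show ?thesis by (simp add: measure_def)
    qed
    have "partition_entropy \<nu> (iterated_join \<nu> g \<xi> n)
        = partition_entropy \<mu> (iterated_join \<mu> f (C ` \<xi> - {{}}) n)" for n
      using partition_entropy_iterated_join[OF sp(2) fin d1, of \<xi> g n] ne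
        partition_entropy_iterated_join[OF sp(1) fin d2 refl, of f n] cell
      by (simp cong: sum.cong)
    then have "entropy_wrt \<nu> g \<xi> = entropy_wrt \<mu> f (C ` \<xi> - {{}})"
      by (simp add: entropy_wrt_def)
    also have "\<dots> \<le> ks_entropy \<mu> f"
      unfolding ks_entropy_def using fmp by (intro SUP_upper) simp
    finally show ?thesis .
  qed
  then show ?thesis
    unfolding ks_entropy_def[of \<nu>] by (intro SUP_least) simp
qed

section \<open>Atoms carry no entropy\<close>

text \<open>The function \<open>p \<mapsto> - p * ln p\<close> is concave, so it lies below its tangent at \<open>q\<close>.\<close>

lemma entropy_term_le_tangent:
  assumes "0 \<le> p" and "0 < q"
  shows "entropy_term p \<le> - p * ln q + q - p"
proof (cases "p = 0")
  case False
  then have p: "0 < p" using assms by simp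
  have "ln (q / p) \<le> q / p - 1" using p assms by (intro ln_le_minus_one) simp
  then have "p * (ln q - ln p) \<le> p * (q / p - 1)"
    using p assms by (intro mult_left_mono) (auto simp: ln_div)
  then show ?thesis using p by (simp add: entropy_term_def algebra_simps)
qed (use assms in \<open>simp add: entropy_term_def\<close>)

lemma entropy_term_le_one: "0 \<le> p \<Longrightarrow> entropy_term p \<le> 1"
  using entropy_term_le_tangent[of p 1] by simp

lemma entropy_term_nonneg: "0 \<le> p \<Longrightarrow> p \<le> 1 \<Longrightarrow> 0 \<le> entropy_term p"
  by (cases "p = 0") (auto simp: entropy_term_def mult_nonneg_nonpos)

lemma entropy_term_add:
  assumes "0 \<le> p" and "0 \<le> q"
  shows "entropy_term (p + q) \<le> entropy_term p + entropy_term q"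
proof -
  have "x * ln x \<le> x * ln (x + y)" if "0 \<le> x" "0 \<le> y" for x y :: real
    using that by (cases "x = 0") (auto intro!: mult_left_mono)
  from this[of p q] this[of q p] show ?thesis
    using assms by (simp add: entropy_term_def algebra_simps)
qed

lemma entropy_term_mult:
  assumes "0 \<le> p" and "0 \<le> q"
  shows "entropy_term (p * q) = p * entropy_term q + q * entropy_term p"
  using assms by (cases "p = 0 \<or> q = 0") (auto simp: entropy_term_def ln_mult algebra_simps)

text \<open>Continuity from above along an enumeration of \<open>D\<close>.\<close>

lemma finite_subset_large_measure:
  assumes "finite_measure \<mu>" and D: "countable D" "\<And>x. x \<in> D \<Longrightarrow> {x} \<in> sets \<mu>" and "\<delta> > 0"
  obtains F where "finite F" "F \<subseteq> D" "measure \<mu> (D - F) < \<delta>"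
proof (cases "D = {}")
  case True
  show ?thesis by (rule that[of "{}"]) (use True \<open>\<delta> > 0\<close> in auto)
next
  case False
  interpret finite_measure \<mu> by fact
  have sub: "E \<in> sets \<mu>" if "E \<subseteq> D" for E
    by (rule sets.countable[OF _ countable_subset[OF that D(1)]]) (use that D(2) in blast)
  define R where "R n = D - from_nat_into D ` {..<n}" for n :: nat
  have "(\<lambda>n. measure \<mu> (R n)) \<longlonglongrightarrow> measure \<mu> (\<Inter>n. R n)"
    by (rule finite_Lim_measure_decseq) (auto simp: R_def decseq_def intro!: sub)
  moreover have "(\<Inter>n. R n) = {}"
  proof -
    have "\<exists>n. x \<notin> R n" for x
    proof (cases "x \<in> D")
      case True
      then obtain m where "from_nat_into D m = x"
        using from_nat_into_surj[OF D(1)] by blast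
      then have "x \<notin> R (Suc m)" by (auto simp: R_def)
      then show ?thesis ..
    qed (simp add: R_def)
    then show ?thesis by blast
  qed
  ultimately have "(\<lambda>n. measure \<mu> (R n)) \<longlonglongrightarrow> 0" by simp
  then have "eventually (\<lambda>n. measure \<mu> (R n) < \<delta>) sequentially"
    using \<open>\<delta> > 0\<close> by (rule order_tendstoD)
  then obtain n where "measure \<mu> (R n) < \<delta>"
    using eventually_happens by force
  then show ?thesis
    using that[of "from_nat_into D ` {..<n}"] from_nat_into[OF False]
    by (auto simp: R_def)
qed

lemma sum_measure_cells_le:
  assumes "finite_measure \<mu>" and "finite I" and "disjoint_family_on E I"
    and "\<And>i. i \<in> I \<Longrightarrow> E i \<in> sets \<mu>" and "Z \<in> sets \<mu>"
  shows "(\<Sum>i\<in>I. measure \<mu> (E i \<inter> Z)) \<le> measure \<mu> Z"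
proof -
  interpret finite_measure \<mu> by fact
  have "(\<Sum>i\<in>I. measure \<mu> (E i \<inter> Z)) = measure \<mu> (\<Union>i\<in>I. E i \<inter> Z)"
    using assms by (intro finite_measure_finite_Union[symmetric])
      (auto simp: disjoint_family_on_def)
  also have "\<dots> \<le> measure \<mu> Z"
    using assms by (intro finite_measure_mono) auto
  finally show ?thesis .
qed

text \<open>For \<open>\<mu> Y = 0\<close> both sides are \<open>0\<close>, so the estimates below need no case distinction.\<close>

lemma measure_conditional:
  assumes "finite_measure \<mu>" and "X \<in> sets \<mu>" and "Y \<in> sets \<mu>"
  shows "measure (uniform_measure \<mu> Y) X = measure \<mu> (X \<inter> Y) / measure \<mu> Y"
proof (cases "emeasure \<mu> Y = 0")
  case True
  then have "emeasure \<mu> (Y \<inter> X) = 0"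
    using assms by (metis Int_lower1 emeasure_mono le_zero_eq)
  then show ?thesis using True assms by (simp add: measure_def)
next
  case False
  interpret finite_measure \<mu> by fact
  show ?thesis using False assms by (simp add: Int_commute)
qed

text \<open>Summing the tangent bound at the uniform weight \<open>q = 1 / card I\<close>. Applied to the \<open>k ^ n\<close> itinerary cells
  restricted to a small set, this gives a small multiple of \<open>n\<close>, up to a constant.\<close>

lemma sum_entropy_term_small_mass:
  assumes I: "finite I" "I \<noteq> {}" and p: "\<And>i. i \<in> I \<Longrightarrow> 0 \<le> p i"
  shows "(\<Sum>i\<in>I. entropy_term (p i)) \<le> (\<Sum>i\<in>I. p i) * ln (card I) + 1"
proof -
  let ?k = "real (card I)"
  have k: "?k > 0" using I by (simp add: card_gt_0_iff)
  have "(\<Sum>i\<in>I. entropy_term (p i)) \<le> (\<Sum>i\<in>I. p i * ln ?k + 1 / ?k)"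
  proof (rule sum_mono)
    fix i assume i: "i \<in> I"
    have "entropy_term (p i) \<le> - p i * ln (1 / ?k) + 1 / ?k - p i"
      using p[OF i] k by (intro entropy_term_le_tangent) auto
    then show "entropy_term (p i) \<le> p i * ln ?k + 1 / ?k"
      using p[OF i] k by (simp add: ln_div)
  qed
  also have "\<dots> = (\<Sum>i\<in>I. p i) * ln ?k + 1"
    using k by (simp add: sum.distrib sum_distrib_right)
  finally show ?thesis .
qed

text \<open>At most \<open>card F\<close> of the disjoint sets meet \<open>F\<close>, and each term is at most \<open>1\<close>.\<close>

lemma sum_entropy_term_finite_set:
  assumes I: "finite I" and dis: "disjoint_family_on E I" and F: "finite F"
  shows "(\<Sum>i\<in>I. entropy_term (measure \<mu> (E i \<inter> F))) \<le> real (card F)"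
proof -
  have "(\<Sum>i\<in>I. entropy_term (measure \<mu> (E i \<inter> F))) \<le> (\<Sum>i\<in>I. real (card (E i \<inter> F)))"
  proof (rule sum_mono)
    fix i
    show "entropy_term (measure \<mu> (E i \<inter> F)) \<le> real (card (E i \<inter> F))"
    proof (cases "E i \<inter> F = {}")
      case True
      then show ?thesis by (simp add: entropy_term_def)
    next
      case False
      then have "1 \<le> real (card (E i \<inter> F))"
        using F by (simp add: Suc_le_eq card_gt_0_iff)
      then show ?thesis
        using entropy_term_le_one[of "measure \<mu> (E i \<inter> F)"] by simp
    qed
  qed
  also have "\<dots> = real (card (\<Union>i\<in>I. E i \<inter> F))"
    using I F dis by (subst card_UN_disjoint) (auto simp: disjoint_family_on_def)
  also have "\<dots> \<le> real (card F)"
    using F by (simp add: card_mono)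
  finally show ?thesis .
qed

text \<open>With \<open>s = \<mu> Y\<close> and conditional probabilities \<open>v i\<close>, the product rule for \<open>entropy_term\<close> writes the left
  side as \<open>s\<close> times the conditional entropy plus \<open>entropy_term s\<close> times the total conditional mass;
  the latter is at most \<open>1\<close>.\<close>

lemma sum_entropy_term_conditional:
  assumes "prob_space \<mu>" and I: "finite I" and dis: "disjoint_family_on E I"
    and E: "\<And>i. i \<in> I \<Longrightarrow> E i \<in> sets \<mu>" and Y: "Y \<in> sets \<mu>"
  shows "(\<Sum>i\<in>I. entropy_term (measure \<mu> (E i \<inter> Y)))
      \<le> (\<Sum>i\<in>I. entropy_term (measure (uniform_measure \<mu> Y) (E i))) + 1"
proof -
  interpret prob_space \<mu> by fact
  let ?s = "measure \<mu> Y"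
  define v where "v i = measure (uniform_measure \<mu> Y) (E i)" for i
  have v: "v i = measure \<mu> (E i \<inter> Y) / ?s" if "i \<in> I" for i
    using E Y that by (simp add: v_def measure_conditional finite_measure_axioms)
  have v01: "0 \<le> v i" "v i \<le> 1" if "i \<in> I" for i
    unfolding v[OF that] using Y E[OF that]
    by (auto intro!: divide_le_eq_1[THEN iffD2] finite_measure_mono simp: zero_less_measure_iff)
  have sv: "measure \<mu> (E i \<inter> Y) = ?s * v i" if "i \<in> I" for i
  proof (cases "?s = 0")
    case True
    then have "measure \<mu> (E i \<inter> Y) = 0"
      using finite_measure_mono[of "E i \<inter> Y" Y] Y by (simp add: measure_le_0_iff)
    then show ?thesis using True by simp
  qed (simp add: v[OF that])
  have sum1: "(\<Sum>i\<in>I. v i) \<le> 1"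
  proof -
    have "(\<Sum>i\<in>I. v i) = (\<Sum>i\<in>I. measure \<mu> (E i \<inter> Y)) / ?s"
      by (simp add: v sum_divide_distrib)
    also have "\<dots> \<le> ?s / ?s"
      by (intro divide_right_mono sum_measure_cells_le finite_measure_axioms I dis E Y) auto
    also have "\<dots> \<le> 1" by simp
    finally show ?thesis .
  qed
  have "(\<Sum>i\<in>I. entropy_term (measure \<mu> (E i \<inter> Y))) \<le> (\<Sum>i\<in>I. entropy_term (v i) + v i)"
  proof (rule sum_mono)
    fix i assume i: "i \<in> I"
    have "entropy_term (measure \<mu> (E i \<inter> Y)) = ?s * entropy_term (v i) + v i * entropy_term ?s"
      using v01[OF i] by (simp add: sv[OF i] entropy_term_mult)
    also have "\<dots> \<le> 1 * entropy_term (v i) + v i * 1"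
      using v01[OF i] by (intro add_mono mult_right_mono mult_left_mono)
        (auto simp: entropy_term_nonneg entropy_term_le_one)
    finally show "entropy_term (measure \<mu> (E i \<inter> Y)) \<le> entropy_term (v i) + v i" by simp
  qed
  also have "\<dots> \<le> (\<Sum>i\<in>I. entropy_term (v i)) + 1"
    using sum1 by (simp add: sum.distrib)
  finally show ?thesis by (simp add: v_def)
qed

text \<open>A linear error of arbitrarily small slope disappears in the growth rate.\<close>

lemma limsup_ennreal_div_le:
  fixes a b :: "nat \<Rightarrow> real"
  assumes le: "\<And>\<epsilon>. \<epsilon> > 0 \<Longrightarrow> \<exists>K\<ge>0. \<forall>n. a n \<le> b n + \<epsilon> * real n + K"
  shows "limsup (\<lambda>n. ennreal (a n / real n)) \<le> limsup (\<lambda>n. ennreal (b n / real n))"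
proof (rule ennreal_le_epsilon)
  fix e :: real assume "0 < e"
  then obtain K where K: "K \<ge> 0" "\<And>n. a n \<le> b n + e / 2 * real n + K"
    using le[of "e / 2"] by auto
  have "eventually (\<lambda>n. n > 0 \<and> real n \<ge> 2 * K / e) sequentially"
    by (intro eventually_conj eventually_gt_at_top)
      (use eventually_ge_at_top[of "nat \<lceil>2 * K / e\<rceil>"] in eventually_elim, linarith)
  then have "eventually (\<lambda>n. ennreal (a n / real n) \<le> ennreal e + ennreal (b n / real n)) sequentially"
  proof eventually_elim
    case (elim n)
    then have "K \<le> e / 2 * real n" using \<open>0 < e\<close> by (simp add: field_simps)
    then have "a n \<le> b n + e * real n" using K(2)[of n] by (simp add: field_simps)
    then have "a n / real n \<le> e + b n / real n" using elim by (simp add: field_simps)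
    also have "\<dots> \<le> e + max 0 (b n / real n)" by simp
    finally have "ennreal (a n / real n) \<le> ennreal (e + max 0 (b n / real n))"
      by (rule ennreal_leI)
    also have "\<dots> = ennreal e + ennreal (b n / real n)"
      using \<open>0 < e\<close> by (simp add: ennreal_plus max_def ennreal_neg)
    finally show ?case .
  qed
  then have "limsup (\<lambda>n. ennreal (a n / real n)) \<le> limsup (\<lambda>n. ennreal e + ennreal (b n / real n))"
    by (rule Limsup_mono)
  also have "\<dots> = ennreal e + limsup (\<lambda>n. ennreal (b n / real n))"
    by (rule Limsup_const_add) simp
  finally show "limsup (\<lambda>n. ennreal (a n / real n)) \<le> limsup (\<lambda>n. ennreal (b n / real n)) + ennreal e"
    by (simp add: add.commute)
qed

text \<open>A countable set carries no entropy. Cut every itinerary cell into its parts in \<open>- D\<close>, in a finite \<open>F \<subseteq> D\<close>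
  and in \<open>D - F\<close>, and use subadditivity of \<open>entropy_term\<close>. The first parts give at most the entropy of the conditional
  measure plus at most \<open>1\<close>, the second at most \<open>card F\<close>, the third at most \<open>\<epsilon> * n + 1\<close> if \<open>F\<close> carries enough of
  the mass of \<open>D\<close>.\<close>

lemma entropy_wrt_le_off_countable:
  fixes \<mu> :: "'a::polish_space measure"
  assumes "prob_space \<mu>" and \<mu>: "sets \<mu> = sets borel" and f: "f \<in> borel_measurable borel"
    and \<xi>: "finite_meas_partition \<mu> \<xi>" and D: "countable D"
  shows "entropy_wrt \<mu> f \<xi> \<le> entropy_wrt (uniform_measure \<mu> (- D)) f \<xi>"
  unfolding entropy_wrt_def
proof (rule limsup_ennreal_div_le)
  fix \<epsilon> :: real assume "\<epsilon> > 0"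
  interpret prob_space \<mu> by fact
  let ?\<nu> = "uniform_measure \<mu> (- D)"
  have sp: "space \<mu> = UNIV" using sets_eq_imp_space_eq[OF \<mu>] by simp
  have fin: "finite \<xi>" and U: "\<Union>\<xi> = UNIV" and dis: "disjoint \<xi>" and ne: "{} \<notin> \<xi>"
    and bor: "\<xi> \<subseteq> sets borel"
    using \<xi> by (auto simp: finite_meas_partition_def partition_on_def sp \<mu>)
  have d: "disjoint_family_on (\<lambda>A. A) \<xi>"
    using dis by (auto simp: disjoint_family_on_def disjoint_def)
  have "\<xi> \<noteq> {}" using U by auto
  then have k: "card \<xi> > 0" using fin by (simp add: card_gt_0_iff)
  \<comment> \<open>The summand \<open>1\<close> keeps the denominator positive when \<open>\<xi>\<close> has a single element.\<close>
  have pos: "\<epsilon> / (1 + ln (card \<xi>)) > 0"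
    using \<open>\<epsilon> > 0\<close> k by (intro divide_pos_pos add_pos_nonneg) (auto simp: Suc_leI)
  have singleton: "{x} \<in> sets \<mu>" for x using \<mu> by simp
  obtain F where F: "finite F" "F \<subseteq> D" "measure \<mu> (D - F) < \<epsilon> / (1 + ln (card \<xi>))"
    using finite_subset_large_measure[OF finite_measure_axioms D singleton pos] .
  have Db: "E \<in> sets borel" if "E \<subseteq> D" for E
    by (rule sets.countable) (auto intro: countable_subset[OF that D])
  have Z: "measure \<mu> (D - F) * ln (card \<xi>) \<le> \<epsilon>"
  proof -
    have "measure \<mu> (D - F) * ln (card \<xi>) \<le> measure \<mu> (D - F) * (1 + ln (card \<xi>))"
      by (intro mult_left_mono) auto
    also have "\<dots> \<le> \<epsilon> / (1 + ln (card \<xi>)) * (1 + ln (card \<xi>))"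
      using F k by (intro mult_right_mono) auto
    also have "1 + ln (real (card \<xi>)) \<noteq> 0"
      using k by (metis add_pos_nonneg less_irrefl ln_ge_zero of_nat_1 of_nat_le_iff Suc_leI One_nat_def zero_less_one)
    then have "\<epsilon> / (1 + ln (card \<xi>)) * (1 + ln (card \<xi>)) = \<epsilon>" by simp
    finally show ?thesis .
  qed
  have "partition_entropy \<mu> (iterated_join \<mu> f \<xi> n)
      \<le> partition_entropy ?\<nu> (iterated_join ?\<nu> f \<xi> n) + \<epsilon> * real n + (real (card F) + 2)" for n
  proof -
    let ?W = "{..<n} \<rightarrow>\<^sub>E \<xi>"
    let ?c = "itinerary_cell f (\<lambda>A. A) n"
    have W: "finite ?W" "?W \<noteq> {}" "card ?W = card \<xi> ^ n"
      using fin \<open>\<xi> \<noteq> {}\<close> by (auto simp: finite_PiE card_PiE PiE_eq_empty_iff)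
    have cb: "?c w \<in> sets \<mu>" if "w \<in> ?W" for w
      unfolding \<mu> using bor by (intro itinerary_cell_borel[OF f _ that]) auto
    have cd: "disjoint_family_on ?c ?W" by (rule itinerary_cells_disjoint[OF d])
    have DF: "- D \<in> sets \<mu>" "D - F \<in> sets \<mu>" "F \<in> sets \<mu>"
      using Db[of D] Db[of "D - F"] Db[of F] F \<mu> by auto
    have "partition_entropy \<mu> (iterated_join \<mu> f \<xi> n) = (\<Sum>w\<in>?W. entropy_term (measure \<mu> (?c w)))"
      using partition_entropy_iterated_join[OF sp fin d, of \<xi> f n] ne by simp
    also have "\<dots> \<le> (\<Sum>w\<in>?W. entropy_term (measure \<mu> (?c w \<inter> - D))
        + (entropy_term (measure \<mu> (?c w \<inter> F)) + entropy_term (measure \<mu> (?c w \<inter> (D - F)))))"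
    proof (rule sum_mono)
      fix w assume w: "w \<in> ?W"
      note sets = cb[OF w] DF
      have 1: "measure \<mu> (?c w) = measure \<mu> (?c w \<inter> - D)
          + measure \<mu> (?c w \<inter> F \<union> ?c w \<inter> (D - F))"
        using sets F by (subst finite_measure_Union[symmetric]) (auto intro!: arg_cong[of _ _ "measure \<mu>"])
      have 2: "measure \<mu> (?c w \<inter> F \<union> ?c w \<inter> (D - F))
          = measure \<mu> (?c w \<inter> F) + measure \<mu> (?c w \<inter> (D - F))"
        using sets F by (intro finite_measure_Union) auto
      have "entropy_term (measure \<mu> (?c w)) \<le> entropy_term (measure \<mu> (?c w \<inter> - D))
          + entropy_term (measure \<mu> (?c w \<inter> F) + measure \<mu> (?c w \<inter> (D - F)))"
        unfolding 1 2 by (intro entropy_term_add) auto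
      also have "\<dots> \<le> entropy_term (measure \<mu> (?c w \<inter> - D))
          + (entropy_term (measure \<mu> (?c w \<inter> F)) + entropy_term (measure \<mu> (?c w \<inter> (D - F))))"
        by (intro add_left_mono entropy_term_add) auto
      finally show "entropy_term (measure \<mu> (?c w)) \<le> \<dots>" .
    qed
    also have "\<dots> = (\<Sum>w\<in>?W. entropy_term (measure \<mu> (?c w \<inter> - D)))
        + ((\<Sum>w\<in>?W. entropy_term (measure \<mu> (?c w \<inter> F)))
        + (\<Sum>w\<in>?W. entropy_term (measure \<mu> (?c w \<inter> (D - F)))))"
      by (simp add: sum.distrib)
    also have "\<dots> \<le> ((\<Sum>w\<in>?W. entropy_term (measure ?\<nu> (?c w))) + 1)
        + (real (card F) + (\<epsilon> * real n + 1))"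
    proof (intro add_mono)
      show "(\<Sum>w\<in>?W. entropy_term (measure \<mu> (?c w \<inter> - D)))
          \<le> (\<Sum>w\<in>?W. entropy_term (measure ?\<nu> (?c w))) + 1"
        by (intro sum_entropy_term_conditional prob_space_axioms W cd cb DF)
      show "(\<Sum>w\<in>?W. entropy_term (measure \<mu> (?c w \<inter> F))) \<le> real (card F)"
        by (intro sum_entropy_term_finite_set W cd F)
      have "(\<Sum>w\<in>?W. entropy_term (measure \<mu> (?c w \<inter> (D - F))))
          \<le> (\<Sum>w\<in>?W. measure \<mu> (?c w \<inter> (D - F))) * ln (card ?W) + 1"
        by (intro sum_entropy_term_small_mass W) auto
      also have "\<dots> \<le> measure \<mu> (D - F) * ln (card ?W) + 1"
        using k by (intro add_right_mono mult_right_mono sum_measure_cells_le finite_measure_axioms W cd cb DF)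
          (auto simp: W(3) Suc_leI)
      also have "measure \<mu> (D - F) * ln (card ?W) = measure \<mu> (D - F) * ln (card \<xi>) * real n"
        using k by (simp add: W(3) ln_realpow)
      also have "\<dots> \<le> \<epsilon> * real n"
        using Z by (intro mult_right_mono) auto
      finally show "(\<Sum>w\<in>?W. entropy_term (measure \<mu> (?c w \<inter> (D - F)))) \<le> \<epsilon> * real n + 1" by simp
    qed
    also have "(\<Sum>w\<in>?W. entropy_term (measure ?\<nu> (?c w))) = partition_entropy ?\<nu> (iterated_join ?\<nu> f \<xi> n)"
      using partition_entropy_iterated_join[of ?\<nu> \<xi> "\<lambda>A. A" \<xi> f n] sp fin d ne by simp
    finally show ?thesis by simp
  qed
  then show "\<exists>K\<ge>0. \<forall>n. partition_entropy \<mu> (iterated_join \<mu> f \<xi> n)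
      \<le> partition_entropy ?\<nu> (iterated_join ?\<nu> f \<xi> n) + \<epsilon> * real n + K"
    by (intro exI[of _ "real (card F) + 2"]) auto
qed

lemma ks_entropy_le_off_countable:
  fixes \<mu> :: "'a::polish_space measure"
  assumes "prob_space \<mu>" and "sets \<mu> = sets borel" and "f \<in> borel_measurable borel"
    and "countable D"
  shows "ks_entropy \<mu> f \<le> ks_entropy (uniform_measure \<mu> (- D)) f"
  unfolding ks_entropy_def
proof (rule SUP_mono)
  fix \<xi> assume \<xi>: "\<xi> \<in> {\<xi>. finite_meas_partition \<mu> \<xi>}"
  then have "finite_meas_partition (uniform_measure \<mu> (- D)) \<xi>"
    by (simp add: finite_meas_partition_def)
  then show "\<exists>\<eta>\<in>{\<xi>. finite_meas_partition (uniform_measure \<mu> (- D)) \<xi>}.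
      entropy_wrt \<mu> f \<xi> \<le> entropy_wrt (uniform_measure \<mu> (- D)) f \<eta>"
    using entropy_wrt_le_off_countable[OF assms(1-3) _ assms(4), of \<xi>] \<xi> by blast
qed

lemma ks_entropy_zero_measure:
  assumes "\<And>E. measure \<nu> E = 0"
  shows "ks_entropy \<nu> f = 0"
proof -
  have "limsup (\<lambda>n. 0 :: ennreal) = 0" by (rule Limsup_const) simp
  then have "entropy_wrt \<nu> f \<xi> = 0" for \<xi>
    by (simp add: entropy_wrt_def partition_entropy_def assms)
  then have "ks_entropy \<nu> f \<le> 0" unfolding ks_entropy_def by (intro SUP_least) simp
  then show ?thesis by simp
qed

section \<open>The non-atomic part of a fair measure\<close>

text \<open>By invariance \<open>\<mu> {x} \<le> \<mu> (f -` {f x}) = \<mu> {f x}\<close>, so images of atoms are atoms. As \<open>D\<close> and \<open>f -` D\<close> have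
  the same finite measure, the inclusion is an equality up to a null set.\<close>

lemma atoms_invariant_mod_null:
  fixes \<mu> :: "'a::polish_space measure"
  assumes inv: "invariant_prob f \<mu>" and f: "f \<in> borel_measurable borel"
  defines "D \<equiv> {x. measure \<mu> {x} \<noteq> 0}"
  shows "countable D" and "D \<subseteq> f -` D" and "f -` D - D \<in> null_sets \<mu>"
proof -
  have sets: "sets \<mu> = sets borel" and "prob_space \<mu>"
    and pre: "\<And>B. B \<in> sets borel \<Longrightarrow> measure \<mu> (f -` B) = measure \<mu> B"
    using inv by (auto simp: invariant_prob_def measure_def)
  interpret prob_space \<mu> by fact
  show cD: "countable D" unfolding D_def by (rule countable_support)
  show sub: "D \<subseteq> f -` D"
  proof
    fix x assume "x \<in> D"
    then have "0 < measure \<mu> {x}" by (simp add: D_def zero_less_measure_iff)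
    also have "\<dots> \<le> measure \<mu> (f -` {f x})"
      using borel_vimage[OF f, of "{f x}"] sets by (intro finite_measure_mono) auto
    also have "\<dots> = measure \<mu> {f x}" by (rule pre) simp
    finally show "x \<in> f -` D" by (simp add: D_def)
  qed
  have Db: "D \<in> sets borel" by (rule countable_borel_set[OF cD])
  have fD: "f -` D \<in> sets borel" by (rule borel_vimage[OF f Db])
  have "measure \<mu> (f -` D - D) = measure \<mu> (f -` D) - measure \<mu> D"
    using sub Db fD sets by (intro finite_measure_Diff) auto
  also have "\<dots> = 0" using pre[OF Db] by simp
  finally show "f -` D - D \<in> null_sets \<mu>"
    using Db fD sets by (auto simp: null_sets_def emeasure_eq_measure)
qed

text \<open>As \<open>Y\<close> is invariant up to a null set, restricting to \<open>Y\<close> a set of the form \<open>A \<inter> f -` B\<close> amounts to replacing \<open>B\<close> by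
  \<open>B \<inter> Y\<close>, which has the same branches unless it is empty.\<close>

lemma fair_measure_conditional:
  fixes \<mu> :: "'a::polish_space measure"
  assumes fair: "fair_measure f \<mu>" and f: "f \<in> borel_measurable borel"
    and Y: "Y \<in> sets borel" "emeasure \<mu> Y \<noteq> 0"
    and sub: "f -` Y \<subseteq> Y" and null: "Y - f -` Y \<in> null_sets \<mu>"
  shows "fair_measure f (uniform_measure \<mu> Y)"
proof -
  let ?\<nu> = "uniform_measure \<mu> Y"
  have sets: "sets \<mu> = sets borel" and "prob_space \<mu>"
    and pre: "\<And>B. B \<in> sets borel \<Longrightarrow> emeasure \<mu> (f -` B) = emeasure \<mu> B"
    using fair by (auto simp: fair_measure_def invariant_prob_def)
  interpret prob_space \<mu> by fact
  have nu: "emeasure ?\<nu> B = emeasure \<mu> (B \<inter> Y) / emeasure \<mu> Y" if "B \<in> sets borel" for B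
    using that Y sets by (simp add: Int_commute)
  have cut: "emeasure \<mu> (A \<inter> f -` B \<inter> Y) = emeasure \<mu> (A \<inter> f -` (B \<inter> Y))"
    if "A \<in> sets borel" "B \<in> sets borel" for A B
  proof -
    have fb: "f -` B \<in> sets borel" using borel_vimage[OF f that(2)] .
    have "emeasure \<mu> (A \<inter> f -` B \<inter> Y) = emeasure \<mu> (A \<inter> f -` B \<inter> Y - (Y - f -` Y))"
      using that fb Y sets null by (intro emeasure_Diff_null_set[symmetric]) auto
    also have "A \<inter> f -` B \<inter> Y - (Y - f -` Y) = A \<inter> f -` (B \<inter> Y)"
      using sub by auto
    finally show ?thesis .
  qed
  have "prob_space ?\<nu>"
    using Y by (intro prob_space_uniform_measure) auto
  moreover have "emeasure ?\<nu> (f -` B) = emeasure ?\<nu> B" if B: "B \<in> sets borel" for B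
    using cut[of UNIV B] pre[of "B \<inter> Y"] B Y borel_vimage[OF f B]
    by (simp add: nu)
  moreover have "emeasure ?\<nu> (A \<inter> f -` B) = emeasure ?\<nu> B / branch_count f P B"
    if P: "iso_partition f P" and B: "B \<in> sets borel"
      and cell: "\<exists>C\<in>image_refinement f P. B \<subseteq> C" and A: "A \<in> branches f P B" for P B A
  proof -
    have Ab: "A \<in> sets borel" using A P by (auto simp: branches_def iso_partition_def)
    then have AB: "A \<inter> f -` B \<in> sets borel"
      using borel_vimage[OF f B] by auto
    have eq: "emeasure ?\<nu> (A \<inter> f -` B) = emeasure \<mu> (A \<inter> f -` (B \<inter> Y)) / emeasure \<mu> Y"
      using nu[OF AB] cut[OF Ab B] by simp
    show ?thesis
    proof (cases "B \<inter> Y = {}")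
      case True
      then show ?thesis using eq nu[OF B] by simp
    next
      case False
      then have "B \<noteq> {}" by auto
      then have dich: "\<forall>A\<in>P. B \<subseteq> f ` A \<or> B \<inter> f ` A = {}"
        using cell by (simp add: subset_refinement_cell_iff)
      then have "\<exists>C\<in>image_refinement f P. B \<inter> Y \<subseteq> C" using cell by blast
      moreover have br: "branches f P (B \<inter> Y) = branches f P B"
        using dich False unfolding branches_def by blast
      moreover have "fair_wrt f P \<mu>" using fair P by (simp add: fair_measure_def)
      moreover have "B \<inter> Y \<in> sets borel" using B Y by auto
      ultimately have "emeasure \<mu> (A \<inter> f -` (B \<inter> Y)) = emeasure \<mu> (B \<inter> Y) / branch_count f P (B \<inter> Y)"
        using A unfolding fair_wrt_def by metis
      then show ?thesis
        using eq nu[OF B] br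
        by (simp add: branch_count_def divide_ennreal_def mult.assoc mult.commute mult.left_commute)
    qed
  qed
  ultimately show ?thesis
    by (simp add: fair_measure_def invariant_prob_def fair_wrt_def sets)
qed

text \<open>Conditioning on the complement of the atoms gives a non-atomic fair measure of at least the same entropy,
  unless the atoms have full measure. In that case \<open>uniform_measure\<close> is the zero measure, whose entropy is \<open>0\<close>,
  and the estimate for countable sets still applies.\<close>

lemma ks_entropy_le_nonatomic:
  fixes \<mu> :: "'a::polish_space measure"
  assumes fair: "fair_measure f \<mu>" and f: "f \<in> borel_measurable borel"
  shows "ks_entropy \<mu> f \<le> (SUP \<nu>\<in>nonatomic_fair_measures f. ks_entropy \<nu> f)"
proof -
  have inv: "invariant_prob f \<mu>" using fair by (simp add: fair_measure_def)
  have sets: "sets \<mu> = sets borel" and "prob_space \<mu>"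
    using inv by (auto simp: invariant_prob_def)
  interpret prob_space \<mu> by fact
  have sp: "space \<mu> = UNIV" using sets_eq_imp_space_eq[OF sets] by simp
  define D where "D = {x. measure \<mu> {x} \<noteq> 0}"
  note D = atoms_invariant_mod_null[OF inv f, folded D_def]
  let ?\<nu> = "uniform_measure \<mu> (- D)"
  have Db: "- D \<in> sets borel" using countable_borel_set[OF D(1)] by auto
  have "ks_entropy \<mu> f \<le> ks_entropy ?\<nu> f"
    by (rule ks_entropy_le_off_countable[OF prob_space_axioms sets f D(1)])
  also have "\<dots> \<le> (SUP \<nu>\<in>nonatomic_fair_measures f. ks_entropy \<nu> f)"
  proof (cases "emeasure \<mu> (- D) = 0")
    case True
    have "measure ?\<nu> E = 0" for E
    proof (cases "E \<in> sets \<mu>")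
      case True
      then show ?thesis
        using \<open>emeasure \<mu> (- D) = 0\<close> Db sets measure_conditional[OF finite_measure_axioms True, of "- D"]
        by (simp add: measure_def)
    qed (simp add: measure_notin_sets)
    then show ?thesis by (simp add: ks_entropy_zero_measure)
  next
    case False
    have "f -` (- D) \<subseteq> - D" "- D - f -` (- D) \<in> null_sets \<mu>"
      using D(2,3) by (auto simp: vimage_Compl Diff_eq Int_commute)
    then have "fair_measure f ?\<nu>"
      by (rule fair_measure_conditional[OF fair f Db False])
    moreover have "emeasure ?\<nu> {x} = 0" for x
    proof (cases "x \<in> D")
      case False
      then have "emeasure \<mu> {x} = 0" by (simp add: D_def emeasure_eq_measure)
      moreover have "- D \<inter> {x} = {x}" using False by auto
      ultimately show ?thesis using Db sets by simp
    qed (use Db sets in simp)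
    then have "non_atomic ?\<nu>" by (simp add: non_atomic_def)
    ultimately show ?thesis
      by (intro SUP_upper) (simp add: nonatomic_fair_measures_def)
  qed
  finally show ?thesis .
qed

lemma fair_entropy_eq_nonatomic:
  assumes "f \<in> borel_measurable borel"
  shows "fair_entropy f = (SUP \<nu>\<in>nonatomic_fair_measures f. ks_entropy \<nu> f)"
  unfolding fair_entropy_def
  using ks_entropy_le_nonatomic[OF _ assms]
  by (intro antisym SUP_least SUP_subset_mono) (auto simp: nonatomic_fair_measures_def)

section \<open>Isomorphic systems have the same non-atomic fair measures and fair entropy\<close>

text \<open>Extending \<open>\<psi>\<close> by a constant on the null set \<open>N1\<close> gives a factor map that is defined everywhere.\<close>

lemma (in borel_iso_mod_countable) ks_entropy_transfer_le:
  assumes \<mu>: "sets \<mu> = sets borel" and null: "emeasure \<mu> N1 = 0"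
  shows "ks_entropy (transfer_measure \<psi> N1 \<mu>) f2 \<le> ks_entropy \<mu> f1"
proof -
  define h where "h x = (if x \<in> N1 then undefined else \<psi> x)" for x
  have h_vimage: "h -` B - N1 = pull B" for B
    by (auto simp: h_def pull_def)
  have hb: "h -` B \<in> sets borel" if "B \<in> sets borel" for B
  proof -
    have "h -` B = pull B \<union> (if undefined \<in> B then N1 else {})"
      by (auto simp: h_def pull_def split: if_splits)
    then show ?thesis using pull_borel[OF that] N_borel by auto
  qed
  have N: "N1 \<in> null_sets \<mu>" using null N_borel \<mu> by (simp add: null_sets_def)
  show ?thesis
  proof (rule ks_entropy_factor_le[OF \<mu> _ f1_measurable f2_measurable _ _ N])
    show "h \<in> borel_measurable borel"
      by (rule measurableI) (simp_all add: hb)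
    show "emeasure (transfer_measure \<psi> N1 \<mu>) B = emeasure \<mu> (h -` B)" if "B \<in> sets borel" for B
      using emeasure_Diff_null_set[OF N, of "h -` B"] hb[OF that] \<mu> that
      by (simp add: emeasure_transfer h_vimage)
    show "(f2 ^^ n) (h x) = h ((f1 ^^ n) x)" if "x \<notin> N1" for n x
      using conjugacy_funpow[OF that, of n] that by (simp add: h_def)
  qed simp
qed

lemma (in borel_iso_mod_countable) ks_entropy_transfer:
  assumes "\<mu> \<in> nonatomic_fair_measures f1"
  shows "ks_entropy (transfer_measure \<psi> N1 \<mu>) f2 = ks_entropy \<mu> f1"
proof (rule antisym)
  interpret inv: borel_iso_mod_countable f2 N2 f1 N1 "inv_into (- N1) \<psi>"
    by (rule inverse_iso)
  note \<mu> = nonatomic_fair_transfer[OF assms]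
  show "ks_entropy (transfer_measure \<psi> N1 \<mu>) f2 \<le> ks_entropy \<mu> f1"
    by (rule ks_entropy_transfer_le[OF \<mu>(1,2)])
  show "ks_entropy \<mu> f1 \<le> ks_entropy (transfer_measure \<psi> N1 \<mu>) f2"
    using inv.ks_entropy_transfer_le[OF inv.nonatomic_fair_transfer(1,2)[OF \<mu>(3)]]
    by (simp add: transfer_inverse[OF \<mu>(1,2)])
qed

theorem theorem5p2:
  fixes f1 :: "'a::polish_space \<Rightarrow> 'a" and f2 :: "'b::polish_space \<Rightarrow> 'b"
    and N1 :: "'a set" and N2 :: "'b set" and \<psi> :: "'a \<Rightarrow> 'b"
  assumes "is_system f1" and "is_system f2"
    and "iso_mod_countable f1 N1 f2 N2 \<psi>"
  shows "bij_betw (transfer_measure \<psi> N1) (nonatomic_fair_measures f1) (nonatomic_fair_measures f2)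
    \<and> (\<forall>\<mu>\<in>nonatomic_fair_measures f1. ks_entropy (transfer_measure \<psi> N1 \<mu>) f2 = ks_entropy \<mu> f1)
    \<and> fair_entropy f1 = fair_entropy f2"
proof -
  have f: "f1 \<in> borel_measurable borel" "f2 \<in> borel_measurable borel"
    using assms by (auto intro: system_borel_measurable)
  interpret borel_iso_mod_countable f1 N1 f2 N2 \<psi>
    by standard (fact assms f)+
  note bij = bij_betw_transfer
  have "(SUP \<nu>\<in>nonatomic_fair_measures f2. ks_entropy \<nu> f2)
      = (SUP \<mu>\<in>nonatomic_fair_measures f1. ks_entropy (transfer_measure \<psi> N1 \<mu>) f2)"
    using bij by (simp add: bij_betw_def image_image flip: bij_betw_imp_surj_on[OF bij])
  also have "\<dots> = (SUP \<mu>\<in>nonatomic_fair_measures f1. ks_entropy \<mu> f1)"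
    by (intro SUP_cong refl ks_entropy_transfer)
  finally show ?thesis
    using bij ks_entropy_transfer f by (simp add: fair_entropy_eq_nonatomic)
qed

end
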